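(* In the setting of the context (a hybrid array with $M\ge 1$ subarrays, per-segment energy functions $E^m_{\rm total}$ and segment endpoints $t^m_{\min}$), the following hold. (i) Non-coherent beamforming: for every $m\in\{2,\dots,M\}$ with $t^m_{\min}<T$, the function $t\mapsto E^m_{\rm total}(t)$ is concave on $[t^m_{\min},\min\{t^{m-1}_{\min},T\})$; and if $\frac{r_{\rm dl}}{W}\ge 1$ (and $t^1_{\min}<T$), the function $t\mapsto E^1_{\rm total}(t)$ is convex on $[t^1_{\min},T]$. (ii) Coherent beamforming: if $\frac{r_{\rm dl}}{W}\ge 1$, then for every $m\in\{1,\dots,M\}$ with $t^m_{\min}<T$, the function $t\mapsto E^m_{\rm total}(t)$ is convex on the segment $[t^m_{\min},\min\{t^{m-1}_{\min},T\})$.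
   Context: Parameters: slot duration $T>0$, bandwidth $W>0$ (the ratio $r_{\rm dl}/W$ is a number, in bit/s/Hz), noise power $\sigma^2>0$, target average data rate $r_{\rm dl}>0$, maximum output power $P_{\max}>0$, maximum power amplifier efficiency $\eta_{\max}>0$, circuit powers $P_{\rm base}$ (transmit mode) and $P_{\rm idle}$ (idle mode). The $M$ subarrays have equivalent channel gains $h_m>0$ and effective channel gains $\kappa_m=\frac{\eta_{\max}}{\sqrt{P_{\max}}}h_m>0$, and are indexed in descending order: $\kappa_1\ge\kappa_2\ge\cdots\ge\kappa_M>0$. There are two modes, non-coherent and coherent beamforming (BF). Define $$\theta(t)=\left(2^{\frac{r_{\rm dl}T}{tW}}-1\right)\sigma^2,\qquad t>0 .$$ For $m\in\{1,\dots,M\}$ let $$S^m_{\max}=\begin{cases}\sum_{i=1}^m P_{\max}\,\eta_{\max}^2\,h_i^2, & \text{non-coherent BF},\\ \left(\sum_{i=1}^m\sqrt{P_{\max}}\,\eta_{\max}\,h_i\right)^2, & \text{coherent BF},\end{cases}\qquad t^m_{\min}=\frac{r_{\rm dl}T}{W\log_2\left(1+\frac{S^m_{\max}}{\sigma^2}\right)},$$ and set $t^0_{\min}=T$. It is assumed that $t^M_{\min}\le T$. One has $t^M_{\min}<\cdots<t^1_{\min}$, and $t^m_{\min}$ is the minimum transmit duration that achieves the rate $r_{\rm dl}$ with subarrays $1,\dots,m$ transmitting at maximum power. For $t$ in the segment $[t^m_{\min},\min\{t^{m-1}_{\min},T\})$ (with $t=T$ also allowed when $m=1$), subarrays $1,\dots,m-1$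 transmit with power $P_{\max}\eta_{\max}^2$, subarrays $m+1,\dots,M$ are off, and subarray $m$ transmits with power $$p_m^*(t)=\begin{cases}\dfrac{\theta(t)-\sum_{i=1}^{m-1}P_{\max}^2\kappa_i^2}{h_m^2}, & \text{non-coherent BF},\\[3mm] \dfrac{\left(\sqrt{\theta(t)}-\sum_{i=1}^{m-1}P_{\max}\kappa_i\right)^2}{h_m^2}, & \text{coherent BF},\end{cases}$$ where empty sums are $0$. The energy objective on this segment (up to terms that do not depend on $t$ there) is $$E^m_{\rm total}(t)=\frac{\sqrt{P_{\max}}}{\eta_{\max}}\sqrt{p_m^*(t)}\;t+\sum_{i=1}^{m-1}P_{\max}\,t+\sum_{i=1}^m(P_{\rm base}-P_{\rm idle})\,t .$$ *)

theory Defs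
  imports "HOL-Analysis.Convex"
begin

text \<open>
  The gains are indexed by \<open>1, \<dots>, num_sub\<close>; values of \<open>gain\<close> outside this range are irrelevant.
  Since the same physical array can be operated in both modes, the mode is a separate argument
  of the quantities that depend on it.
\<close>

record hybrid_array =
  slot :: real       \<comment> \<open>\<open>T\<close>\<close>
  bandwidth :: real  \<comment> \<open>\<open>W\<close>\<close>
  noise :: real      \<comment> \<open>\<open>\<sigma>\<^sup>2\<close>, the noise power itself\<close>
  rate :: real       \<comment> \<open>\<open>r\<^sub>d\<^sub>l\<close>\<close>
  P_max :: real
  eta_max :: real
  P_base :: real
  P_idle :: real
  num_sub :: nat     \<comment> \<open>\<open>M\<close>\<close>
  gain :: "nat \<Rightarrow> real"  \<comment> \<open>\<open>h\<^sub>m\<close>\<close>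

datatype bf_mode = NonCoherent | Coherent

definition kappa :: "hybrid_array \<Rightarrow> nat \<Rightarrow> real" where
  "kappa A m = eta_max A / sqrt (P_max A) * gain A m"

definition theta :: "hybrid_array \<Rightarrow> real \<Rightarrow> real" where
  "theta A t = (2 powr (rate A * slot A / (t * bandwidth A)) - 1) * noise A"

definition S_max :: "hybrid_array \<Rightarrow> bf_mode \<Rightarrow> nat \<Rightarrow> real" where
  "S_max A mode m = (case mode of
      NonCoherent \<Rightarrow> (\<Sum>i=1..m. P_max A * (eta_max A)\<^sup>2 * (gain A i)\<^sup>2)
    | Coherent \<Rightarrow> (\<Sum>i=1..m. sqrt (P_max A) * eta_max A * gain A i)\<^sup>2)"

definition t_min :: "hybrid_array \<Rightarrow> bf_mode \<Rightarrow> nat \<Rightarrow> real" where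
  "t_min A mode m = (if m = 0 then slot A
     else rate A * slot A / (bandwidth A * log 2 (1 + S_max A mode m / noise A)))"

definition p_star :: "hybrid_array \<Rightarrow> bf_mode \<Rightarrow> nat \<Rightarrow> real \<Rightarrow> real" where
  "p_star A mode m t = (case mode of
      NonCoherent \<Rightarrow>
        (theta A t - (\<Sum>i=1..<m. (P_max A)\<^sup>2 * (kappa A i)\<^sup>2)) / (gain A m)\<^sup>2
    | Coherent \<Rightarrow>
        (sqrt (theta A t) - (\<Sum>i=1..<m. P_max A * kappa A i))\<^sup>2 / (gain A m)\<^sup>2)"

definition E_total :: "hybrid_array \<Rightarrow> bf_mode \<Rightarrow> nat \<Rightarrow> real \<Rightarrow> real" where
  "E_total A mode m t =
     sqrt (P_max A) / eta_max A * sqrt (p_star A mode m t) * t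
     + (\<Sum>i=1..<m. P_max A * t)
     + (\<Sum>i=1..m. (P_base A - P_idle A) * t)"

end

theory Submission
  imports Defs
begin

text \<open>
  Up to positive factors and terms linear in \<open>t\<close>, each segment energy is \<open>t * g (k / t)\<close> with
  \<open>g x = sqrt (exp x - d)\<close> and \<open>k = ln 2 * rate * slot / bandwidth\<close>, so it is the perspective of
  \<open>g\<close> and inherits convexity or concavity from it. The sign of \<open>g''\<close> is that of \<open>exp x - 2 * d\<close>.
  In coherent mode (and for \<open>m = 1\<close>) one has \<open>d = 1\<close>, and \<open>exp (k / t) \<ge> 2\<close> because
  \<open>rate / bandwidth \<ge> 1\<close> and \<open>t \<le> slot\<close>. In non-coherent mode with \<open>m \<ge> 2\<close>, \<open>d\<close> is one plus the
  total SNR of the saturated subarrays, and \<open>exp (k / t)\<close> exceeds \<open>d\<close> by at most the maximal SNR of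
  subarray \<open>m\<close>, which by the ordering of the gains is at most \<open>d\<close>.
\<close>

section \<open>Perspectives of convex and concave functions\<close>

text \<open>If \<open>r\<close> is a convex combination of \<open>s\<close> and \<open>t\<close>,
  then \<open>k / r\<close> is one of \<open>k / s\<close> and \<open>k / t\<close>, with new
  weights proportional to the old ones times \<open>s\<close> and \<open>t\<close>. The outer factor
  \<open>r\<close> cancels their normalisation.\<close>

lemma convex_on_perspective:
  fixes g :: "real \<Rightarrow> real"
  assumes g: "convex_on I g" and J: "convex J"
    and pos: "\<And>t. t \<in> J \<Longrightarrow> t > 0" and maps: "\<And>t. t \<in> J \<Longrightarrow> k / t \<in> I"
  shows "convex_on J (\<lambda>t. t * g (k / t))"
proof (rule convex_onI[OF _ J])
  fix w s t :: real
  assume w: "0 < w" "w < 1" and s: "s \<in> J" and t: "t \<in> J"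
  define r where "r = (1 - w) * s + w * t"
  have st: "s > 0" "t > 0" using pos s t by auto
  then have r: "r > 0" using w by (simp add: r_def add_pos_pos)
  \<comment> \<open>The share of \<open>w * t\<close> in \<open>r\<close>: with this weight,
    \<open>s\<close> and \<open>t\<close> cancel against the denominators of \<open>k / s\<close>
    and \<open>k / t\<close>.\<close>
  define a where "a = w * t / r"
  have a1: "1 - a = (1 - w) * s / r"
    using r by (simp add: a_def r_def field_simps)
  have a: "0 \<le> a" "a \<le> 1"
    using w st r a1 by (auto simp: a_def r_def field_simps)
  have "(1 - a) * (k / s) + a * (k / t) = k / r"
    unfolding a1 using st r by (simp add: a_def field_simps)
  moreover have "g ((1 - a) * (k / s) + a * (k / t)) \<le> (1 - a) * g (k / s) + a * g (k / t)"
    using convex_onD[OF g, of a "k / s" "k / t"] a maps s t by simp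
  ultimately have "r * g (k / r) \<le> r * ((1 - a) * g (k / s) + a * g (k / t))"
    using r by simp
  also have "\<dots> = (1 - w) * (s * g (k / s)) + w * (t * g (k / t))"
    unfolding a1 using r by (simp add: a_def field_simps)
  finally show "((1 - w) *\<^sub>R s + w *\<^sub>R t) * g (k / ((1 - w) *\<^sub>R s + w *\<^sub>R t))
      \<le> (1 - w) * (s * g (k / s)) + w * (t * g (k / t))"
    by (simp add: r_def)
qed

lemma concave_on_perspective:
  fixes g :: "real \<Rightarrow> real"
  assumes "concave_on I g" "convex J"
    and "\<And>t. t \<in> J \<Longrightarrow> t > 0" "\<And>t. t \<in> J \<Longrightarrow> k / t \<in> I"
  shows "concave_on J (\<lambda>t. t * g (k / t))"
  using convex_on_perspective[of I "\<lambda>x. - g x" J k] assms by (simp add: concave_on_def)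

section \<open>Second-order behaviour of \<open>sqrt (exp x - d)\<close>\<close>

lemma sqrt_exp_diff_has_derivatives:
  fixes x d :: real
  assumes "d < exp x"
  shows "((\<lambda>x. sqrt (exp x - d)) has_real_derivative exp x / (2 * sqrt (exp x - d))) (at x)"
    and "((\<lambda>x. exp x / (2 * sqrt (exp x - d))) has_real_derivative
          exp x * (exp x - 2 * d) / (4 * (exp x - d) * sqrt (exp x - d))) (at x)"
proof -
  have s: "sqrt (exp x - d) > 0" "sqrt (exp x - d) * sqrt (exp x - d) = exp x - d"
    using assms by auto
  show "((\<lambda>x. sqrt (exp x - d)) has_real_derivative exp x / (2 * sqrt (exp x - d))) (at x)"
    using assms by (auto intro!: derivative_eq_intros simp: field_simps)
  \<comment> \<open>Replacing \<open>exp x\<close> by \<open>q * q + d\<close> makes the outcome of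
    the quotient rule a rational identity in \<open>q\<close> and \<open>d\<close>.\<close>
  define q where "q = sqrt (exp x - d)"
  have q: "q > 0" "exp x - d = q * q" using s by (auto simp: q_def)
  have "(exp x * (2 * q) - exp x * (2 * (exp x / (2 * q)))) / (2 * q * (2 * q))
      = exp x * (exp x - 2 * d) / (4 * (q * q) * q)"
  proof -
    have "exp x = q * q + d" using q(2) by simp
    then show ?thesis using q(1) by (simp add: field_simps)
  qed
  then show "((\<lambda>x. exp x / (2 * sqrt (exp x - d))) has_real_derivative
          exp x * (exp x - 2 * d) / (4 * (exp x - d) * sqrt (exp x - d))) (at x)"
    using assms s
    by (auto intro!: derivative_eq_intros simp: q_def field_simps)
qed

lemma convex_on_sqrt_exp_diff:
  fixes d :: real
  assumes "d > 0"
  shows "convex_on {ln (2 * d)..} (\<lambda>x. sqrt (exp x - d))"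
proof (rule f''_ge0_imp_convex)
  fix x :: real assume "x \<in> {ln (2 * d)..}"
  then have "exp (ln (2 * d)) \<le> exp x" by simp
  then have x: "2 * d \<le> exp x" using assms by simp
  then have "d < exp x" using assms by simp
  then show "((\<lambda>x. sqrt (exp x - d)) has_real_derivative exp x / (2 * sqrt (exp x - d))) (at x)"
    and "((\<lambda>x. exp x / (2 * sqrt (exp x - d))) has_real_derivative
          exp x * (exp x - 2 * d) / (4 * (exp x - d) * sqrt (exp x - d))) (at x)"
    by (rule sqrt_exp_diff_has_derivatives)+
  show "0 \<le> exp x * (exp x - 2 * d) / (4 * (exp x - d) * sqrt (exp x - d))"
    using x \<open>d < exp x\<close> by simp
qed simp

text \<open>The end \<open>ln d\<close> is excluded because the root vanishes and is not
  differentiable there; at \<open>ln (2 * d)\<close> the second derivative changes sign.\<close>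

lemma concave_on_sqrt_exp_diff:
  fixes d :: real
  assumes "d > 0"
  shows "concave_on {ln d<..ln (2 * d)} (\<lambda>x. sqrt (exp x - d))"
proof (rule f''_le0_imp_concave)
  fix x :: real assume "x \<in> {ln d<..ln (2 * d)}"
  then have "exp (ln d) < exp x" "exp x \<le> exp (ln (2 * d))" by auto
  then have x: "d < exp x" "exp x \<le> 2 * d" using assms by auto
  from x(1) show "((\<lambda>x. sqrt (exp x - d)) has_real_derivative
          exp x / (2 * sqrt (exp x - d))) (at x)"
    and "((\<lambda>x. exp x / (2 * sqrt (exp x - d))) has_real_derivative
          exp x * (exp x - 2 * d) / (4 * (exp x - d) * sqrt (exp x - d))) (at x)"
    by (rule sqrt_exp_diff_has_derivatives)+
  show "exp x * (exp x - 2 * d) / (4 * (exp x - d) * sqrt (exp x - d)) \<le> 0"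
    using x by (intro divide_nonpos_nonneg mult_nonneg_nonpos) auto
qed simp

text \<open>Allows a closed form that agrees with the energy only on the segment, as happens in
  coherent mode.\<close>

lemma convex_on_transfer:
  assumes f: "convex_on S f" and eq: "\<And>x. x \<in> S \<Longrightarrow> g x = f x"
  shows "convex_on S g"
  unfolding convex_on_def
proof (intro conjI ballI allI impI)
  show S: "convex S" using f by (rule convex_on_imp_convex)
  fix x y and u v :: real
  assume A: "x \<in> S" "y \<in> S" "0 \<le> u" "0 \<le> v" "u + v = 1"
  then have "u *\<^sub>R x + v *\<^sub>R y \<in> S" using S by (simp add: convexD)
  then show "g (u *\<^sub>R x + v *\<^sub>R y) \<le> u * g x + v * g y"
    using f A by (simp add: eq convex_on_def)
qed

lemma scaling_convex_concave_on:
  fixes c :: real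
  assumes "convex S"
  shows "convex_on S (\<lambda>t. c * t)" "concave_on S (\<lambda>t. c * t)"
  using assms by (auto intro!: convex_onI simp: concave_on_def algebra_simps)

section \<open>The array quantities in terms of \<open>exp (k / t)\<close>\<close>

locale hybrid_array_pos =
  fixes A :: hybrid_array
  assumes pos: "slot A > 0" "bandwidth A > 0" "noise A > 0" "rate A > 0"
      "P_max A > 0" "eta_max A > 0"
    and gain_pos: "\<And>m. m \<in> {1..num_sub A} \<Longrightarrow> gain A m > 0"
begin

text \<open>The factor \<open>ln 2\<close> turns the power of 2 in \<open>theta\<close> into
  \<open>exp (k / t)\<close> and the \<open>log 2\<close> in \<open>t_min\<close> into
  \<open>ln\<close>.\<close>

definition k where "k = ln 2 * rate A * slot A / bandwidth A"

lemma k_pos: "k > 0"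
  using pos by (simp add: k_def)

lemma theta_eq: "theta A t = (exp (k / t) - 1) * noise A"
  by (simp add: theta_def powr_def k_def field_simps)

text \<open>Matches the terms subtracted in \<open>p_star\<close> with those summed in
  \<open>S_max\<close>.\<close>

lemma P_max_kappa: "P_max A * kappa A i = sqrt (P_max A) * eta_max A * gain A i"
  using pos by (simp add: kappa_def field_simps)

lemma P_max_kappa_sq: "(P_max A)\<^sup>2 * (kappa A i)\<^sup>2 = P_max A * (eta_max A)\<^sup>2 * (gain A i)\<^sup>2"
  using pos P_max_kappa[of i]
  by (metis power_mult_distrib real_sqrt_pow2 less_imp_le)

lemma S_max_pos:
  assumes "m \<in> {1..num_sub A}"
  shows "S_max A mode m > 0"
proof -
  have g: "gain A i > 0" if "i \<in> {1..m}" for i using gain_pos assms that by simp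
  have "(\<Sum>i=1..m. P_max A * (eta_max A)\<^sup>2 * (gain A i)\<^sup>2) > 0"
    using assms pos g by (intro sum_pos mult_pos_pos zero_less_power) auto
  moreover have "(\<Sum>i=1..m. sqrt (P_max A) * eta_max A * gain A i) > 0"
    using assms pos g by (intro sum_pos mult_pos_pos) auto
  ultimately show ?thesis by (simp add: S_max_def split: bf_mode.split)
qed

lemma t_min_eq:
  assumes "m \<in> {1..num_sub A}"
  shows "t_min A mode m = k / ln (1 + S_max A mode m / noise A)"
  using assms by (simp add: t_min_def k_def log_def)

lemma t_min_pos:
  assumes "m \<in> {1..num_sub A}"
  shows "t_min A mode m > 0"
proof -
  have "S_max A mode m / noise A > 0" using S_max_pos[OF assms] pos by simp
  then show ?thesis using k_pos by (simp add: t_min_eq[OF assms])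
qed

text \<open>Translates segment endpoints into bounds on the required power:
  \<open>t_min A mode m \<le> t\<close> bounds \<open>theta A t\<close> above by
  \<open>S_max A mode m\<close>, and \<open>t < t_min A mode (m - 1)\<close> bounds it strictly
  below by \<open>S_max A mode (m - 1)\<close>.\<close>

lemma t_min_le_iff:
  assumes m: "m \<in> {1..num_sub A}" and t: "t > 0"
  shows "t_min A mode m \<le> t \<longleftrightarrow> theta A t \<le> S_max A mode m"
proof -
  define s where "s = S_max A mode m / noise A"
  have s: "s > 0" using S_max_pos[OF m] pos by (simp add: s_def)
  have "t_min A mode m \<le> t \<longleftrightarrow> k / t \<le> ln (1 + s)"
    using s t by (simp add: t_min_eq[OF m] s_def[symmetric] field_simps)
  also have "\<dots> \<longleftrightarrow> exp (k / t) \<le> 1 + s"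
    using s by (simp add: ln_ge_iff)
  also have "\<dots> \<longleftrightarrow> theta A t \<le> S_max A mode m"
    using pos by (simp add: theta_eq s_def field_simps)
  finally show ?thesis .
qed

section \<open>Coherent mode and the first non-coherent segment\<close>

text \<open>The perspective of \<open>sqrt (exp x - 1)\<close>, scaled by
  \<open>sqrt (noise A)\<close>; the rate condition and \<open>t \<le> slot A\<close> give
  \<open>k / t \<ge> ln 2\<close>.\<close>

lemma convex_on_time_sqrt_theta:
  assumes "rate A / bandwidth A \<ge> 1" and J: "convex J" "J \<subseteq> {0<..slot A}"
  shows "convex_on J (\<lambda>t. t * sqrt (theta A t))"
proof -
  have "convex_on J (\<lambda>t. t * sqrt (exp (k / t) - 1))"
  proof (rule convex_on_perspective[OF convex_on_sqrt_exp_diff J(1)])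
    fix t assume "t \<in> J"
    then show t: "t > 0" using J by auto
    have "t \<le> slot A" using \<open>t \<in> J\<close> J by auto
    also have "\<dots> \<le> slot A * (rate A / bandwidth A)"
      using assms(1) pos(1) by (simp only: mult_le_cancel_left1) simp
    finally have "ln 2 * t \<le> ln 2 * (slot A * (rate A / bandwidth A))"
      by (intro mult_left_mono) auto
    also have "\<dots> = k" by (simp add: k_def)
    \<comment> \<open>The \<open>2 * 1\<close> is the \<open>2 * d\<close> of
      \<open>convex_on_sqrt_exp_diff\<close> at \<open>d = 1\<close>.\<close>
    finally show "k / t \<in> {ln (2 * 1)..}"
      using t by (simp add: pos_le_divide_eq)
  qed simp
  then have "convex_on J (\<lambda>t. sqrt (noise A) * (t * sqrt (exp (k / t) - 1)))"
    using pos by (intro convex_on_cmul) auto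
  then show ?thesis
    by (simp add: theta_eq real_sqrt_mult mult_ac)
qed

lemma E_total_NonCoherent_1:
  assumes "num_sub A \<ge> 1"
  shows "E_total A NonCoherent 1 t =
    sqrt (P_max A) / eta_max A / gain A 1 * (t * sqrt (theta A t)) + (P_base A - P_idle A) * t"
  using gain_pos[of 1] assms by (simp add: E_total_def p_star_def real_sqrt_divide)

text \<open>The root of the squared difference in \<open>p_star\<close> is an absolute value. On the
  segment \<open>sqrt (theta A t)\<close> is at least the subtracted sum, so the absolute value
  drops and the sum contributes only a term linear in \<open>t\<close>.\<close>

lemma E_total_Coherent:
  assumes m: "m \<in> {1..num_sub A}" and t: "t > 0" "m \<ge> 2 \<Longrightarrow> t < t_min A Coherent (m - 1)"
  shows "E_total A Coherent m t =
    sqrt (P_max A) / eta_max A / gain A m * (t * sqrt (theta A t)) +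
    (real (m - 1) * P_max A + real m * (P_base A - P_idle A)
      - sqrt (P_max A) / eta_max A / gain A m * (\<Sum>i=1..<m. P_max A * kappa A i)) * t"
proof -
  define c where "c = (\<Sum>i=1..<m. P_max A * kappa A i)"
  have "c \<le> sqrt (theta A t)"
  proof (cases "m \<ge> 2")
    case True
    then have m1: "m - 1 \<in> {1..num_sub A}" using m by auto
    have "{1..m - 1} = {1..<m}" using True by auto
    then have "c\<^sup>2 = S_max A Coherent (m - 1)"
      by (simp add: c_def S_max_def P_max_kappa)
    also have "\<dots> \<le> theta A t"
      using t True t_min_le_iff[OF m1 t(1), of Coherent] by fastforce
    finally show ?thesis by (rule real_le_rsqrt)
  next
    \<comment> \<open>Here \<open>m = 1\<close>: the sum is empty, and
      \<open>theta A t \<ge> 0\<close> since \<open>k / t > 0\<close>.\<close>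
    case False
    then show ?thesis using m t(1) pos k_pos by (simp add: c_def theta_eq)
  qed
  then have "sqrt (p_star A Coherent m t) = (sqrt (theta A t) - c) / gain A m"
    using gain_pos[OF m] by (simp add: p_star_def c_def real_sqrt_divide)
  then have p: "sqrt (P_max A) / eta_max A * sqrt (p_star A Coherent m t) * t =
      sqrt (P_max A) / eta_max A / gain A m * (t * sqrt (theta A t)) -
      sqrt (P_max A) / eta_max A / gain A m * c * t"
    by (simp only:) (simp add: field_simps diff_divide_distrib)
  show ?thesis
    unfolding E_total_def c_def[symmetric] p by (simp add: algebra_simps)
qed

lemma convex_on_E_total_Coherent:
  assumes "rate A / bandwidth A \<ge> 1" and m: "m \<in> {1..num_sub A}"
  shows "convex_on {t_min A Coherent m ..< min (t_min A Coherent (m - 1)) (slot A)}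
    (E_total A Coherent m)"
proof -
  let ?J = "{t_min A Coherent m ..< min (t_min A Coherent (m - 1)) (slot A)}"
  have J: "?J \<subseteq> {0<..slot A}" using t_min_pos[OF m, of Coherent] by auto
  have "sqrt (P_max A) / eta_max A / gain A m \<ge> 0"
    using pos gain_pos[OF m] by simp
  then have "convex_on ?J (\<lambda>t.
    sqrt (P_max A) / eta_max A / gain A m * (t * sqrt (theta A t)) +
    (real (m - 1) * P_max A + real m * (P_base A - P_idle A)
      - sqrt (P_max A) / eta_max A / gain A m * (\<Sum>i=1..<m. P_max A * kappa A i)) * t)"
    using J assms(1)
    by (intro convex_on_add scaling_convex_concave_on convex_on_cmul convex_on_time_sqrt_theta) auto
  then show ?thesis
    using E_total_Coherent[OF m] J by (elim convex_on_transfer) auto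
qed

lemma convex_on_E_total_NonCoherent_1:
  assumes "rate A / bandwidth A \<ge> 1" and M: "num_sub A \<ge> 1"
  shows "convex_on {t_min A NonCoherent 1..slot A} (E_total A NonCoherent 1)"
proof -
  have m: "1 \<in> {1..num_sub A}" using M by simp
  have "sqrt (P_max A) / eta_max A / gain A 1 \<ge> 0"
    using pos gain_pos[OF m] by simp
  then have "convex_on {t_min A NonCoherent 1..slot A} (\<lambda>t.
    sqrt (P_max A) / eta_max A / gain A 1 * (t * sqrt (theta A t)) + (P_base A - P_idle A) * t)"
    using t_min_pos[OF m, of NonCoherent] assms(1)
    by (intro convex_on_add scaling_convex_concave_on convex_on_cmul convex_on_time_sqrt_theta) auto
  then show ?thesis
    using E_total_NonCoherent_1[OF M] by (elim convex_on_transfer) auto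
qed

section \<open>Non-coherent mode from the second segment on\<close>

lemma concave_on_E_total_NonCoherent:
  assumes m: "m \<in> {2..num_sub A}" and kappa: "kappa A m \<le> kappa A (m - 1)"
  shows "concave_on {t_min A NonCoherent m ..< min (t_min A NonCoherent (m - 1)) (slot A)}
    (E_total A NonCoherent m)"
proof -
  let ?J = "{t_min A NonCoherent m ..< min (t_min A NonCoherent (m - 1)) (slot A)}"
  have m0: "m \<in> {1..num_sub A}" and m1: "m - 1 \<in> {1..num_sub A}" using m by auto
  have "{1..m - 1} = {1..<m}" using m by auto
  then have c: "(\<Sum>i=1..<m. (P_max A)\<^sup>2 * (kappa A i)\<^sup>2) = S_max A NonCoherent (m - 1)"
    by (simp add: S_max_def P_max_kappa_sq)
  \<comment> \<open>Absorbs both the \<open>- 1\<close> in \<open>theta\<close> and the power of the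
    saturated subarrays.\<close>
  define d where "d = 1 + S_max A NonCoherent (m - 1) / noise A"
  have d: "d > 0" using S_max_pos[OF m1] pos by (simp add: d_def add_pos_pos)
  \<comment> \<open>\<open>sqrt\<close> is multiplicative on all reals, negative ones included, so
    this holds for every \<open>t\<close> and \<open>E\<close> below is an equation between
    functions.\<close>
  have "sqrt (p_star A NonCoherent m t) = sqrt (noise A) / gain A m * sqrt (exp (k / t) - d)" for t
  proof -
    have "p_star A NonCoherent m t = noise A * (exp (k / t) - d) / (gain A m)\<^sup>2"
    proof -
      have "noise A * (exp (k / t) - d) = theta A t - S_max A NonCoherent (m - 1)"
        using pos by (simp add: theta_eq d_def field_simps)
      then show ?thesis unfolding p_star_def bf_mode.case c by simp
    qed
    then show ?thesis using gain_pos[OF m0] by (simp add: real_sqrt_divide real_sqrt_mult)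
  qed
  then have E: "E_total A NonCoherent m = (\<lambda>t.
      sqrt (P_max A) / eta_max A * (sqrt (noise A) / gain A m) * (t * sqrt (exp (k / t) - d)) +
      (real (m - 1) * P_max A + real m * (P_base A - P_idle A)) * t)"
    using m by (auto simp: E_total_def fun_eq_iff algebra_simps)
  \<comment> \<open>The ordering of the gains enters here: the last term is at most its predecessor,
    which for \<open>m \<ge> 2\<close> is itself one of the nonnegative summands of
    \<open>S_max A NonCoherent (m - 1)\<close>.\<close>
  have S_Suc: "S_max A NonCoherent m \<le> 2 * S_max A NonCoherent (m - 1)"
  proof -
    define f where "f = (\<lambda>i. (P_max A)\<^sup>2 * (kappa A i)\<^sup>2)"
    have S: "S_max A NonCoherent n = sum f {1..n}" for n
      by (simp add: S_max_def f_def P_max_kappa_sq)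
    have "kappa A m \<ge> 0" using gain_pos[OF m0] pos by (simp add: kappa_def)
    then have "f m \<le> f (m - 1)"
      using kappa unfolding f_def by (intro mult_left_mono power_mono) auto
    also have "\<dots> \<le> sum f {1..m - 1}"
      using m by (intro member_le_sum) (auto simp: f_def)
    finally have "f m \<le> sum f {1..m - 1}" .
    moreover have "sum f {1..m} = sum f {1..m - 1} + f m"
      using m by (cases m) auto
    ultimately show ?thesis by (simp add: S)
  qed
  have "concave_on ?J (\<lambda>t. t * sqrt (exp (k / t) - d))"
  proof (rule concave_on_perspective[OF concave_on_sqrt_exp_diff[OF d]])
    fix t assume t: "t \<in> ?J"
    show t0: "t > 0" using t t_min_pos[OF m0, of NonCoherent] by auto
    have "S_max A NonCoherent (m - 1) < theta A t"
      using t t_min_le_iff[OF m1 t0, of NonCoherent] by fastforce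
    then have "d < exp (k / t)"
      using pos by (simp add: d_def theta_eq field_simps)
    moreover have "theta A t \<le> 2 * S_max A NonCoherent (m - 1)"
      using t t_min_le_iff[OF m0 t0, of NonCoherent] S_Suc by fastforce
    \<comment> \<open>The bound on \<open>theta\<close> even yields
      \<open>exp (k / t) \<le> 2 * d - 1\<close>.\<close>
    then have "exp (k / t) \<le> 2 * d"
      using pos by (simp add: d_def theta_eq field_simps)
    ultimately have "ln d < ln (exp (k / t))" "ln (exp (k / t)) \<le> ln (2 * d)"
      using d by (simp_all only: ln_less_cancel_iff ln_le_cancel_iff exp_gt_zero
          zero_less_mult_iff zero_less_numeral simp_thms)
    then show "k / t \<in> {ln d<..ln (2 * d)}" by simp
  qed simp
  moreover have "sqrt (P_max A) / eta_max A * (sqrt (noise A) / gain A m) \<ge> 0"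
    using pos gain_pos[OF m0] by simp
  ultimately show ?thesis
    unfolding E by (intro concave_on_add scaling_convex_concave_on concave_on_cmul) auto
qed

end

section \<open>Both modes together\<close>

theorem theorem2:
  fixes A :: hybrid_array
  assumes "slot A > 0" and "bandwidth A > 0" and "noise A > 0" and "rate A > 0"
    and "P_max A > 0" and "eta_max A > 0"
    and "num_sub A \<ge> 1"
    and "\<And>m. m \<in> {1..num_sub A} \<Longrightarrow> gain A m > 0"
    and "\<And>i j. 1 \<le> i \<Longrightarrow> i \<le> j \<Longrightarrow> j \<le> num_sub A \<Longrightarrow> kappa A j \<le> kappa A i"
  shows
    "(t_min A NonCoherent (num_sub A) \<le> slot A \<longrightarrow>
        (\<forall>m\<in>{2..num_sub A}. t_min A NonCoherent m < slot A \<longrightarrow>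
           concave_on {t_min A NonCoherent m ..< min (t_min A NonCoherent (m - 1)) (slot A)}
             (E_total A NonCoherent m)) \<and>
        (rate A / bandwidth A \<ge> 1 \<longrightarrow> t_min A NonCoherent 1 < slot A \<longrightarrow>
           convex_on {t_min A NonCoherent 1 .. slot A} (E_total A NonCoherent 1)))
     \<and>
     (t_min A Coherent (num_sub A) \<le> slot A \<longrightarrow>
        rate A / bandwidth A \<ge> 1 \<longrightarrow>
        (\<forall>m\<in>{1..num_sub A}. t_min A Coherent m < slot A \<longrightarrow>
           convex_on {t_min A Coherent m ..< min (t_min A Coherent (m - 1)) (slot A)}
             (E_total A Coherent m)))"
proof -
  interpret hybrid_array_pos A
    using assms(1-6,8) by unfold_locales
  show ?thesis
  proof (intro conjI impI ballI)
    fix m assume m: "m \<in> {2..num_sub A}"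
    then have "kappa A m \<le> kappa A (m - 1)" by (intro assms(9)) auto
    with m show "concave_on {t_min A NonCoherent m ..<
        min (t_min A NonCoherent (m - 1)) (slot A)} (E_total A NonCoherent m)"
      by (rule concave_on_E_total_NonCoherent)
  qed (use assms(7) in \<open>blast intro: convex_on_E_total_Coherent convex_on_E_total_NonCoherent_1\<close>)+
qed

end
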